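(* Let $v_0,v_1,\dots,v_n$ be linearly independent vectors in a real inner product space, and let $u_0,u_1,\dots,u_n$ be the orthogonal vectors produced from them by the Gram-Schmidt process (without normalization). For $1\le k\le n$ let $V_k=\mathrm{Span}\{v_0,\dots,v_k\}$, oriented so that the ordered basis $(v_0,v_1,\dots,v_k)$ is positive, and let $\ast$ be the Hodge star operator of $V_k$. Then $$u_k=\frac{\sqrt{d_{k+1,k+1}}}{d_{k,k}}\,\ast(v_0\wedge v_1\wedge\cdots\wedge v_{k-1}).$$
   Context: The Gram-Schmidt process produces $u_k=v_k-\sum_{i=0}^{k-1}\frac{\langle v_k,u_i\rangle}{\langle u_i,u_i\rangle}u_i$ for $0\le k\le n$. For $1\le k\le n+1$, $d_{k,k}=\det(\langle v_i,v_j\rangle)_{0\le i,j\le k-1}$ is the Gram determinant of $v_0,\dots,v_{k-1}$. For an $m$-dimensional oriented real inner product space $W$, the inner product is extended to $\wedge^p W$ by $\langle w_1\wedge\cdots\wedge w_p,\,w_1'\wedge\cdots\wedge w_p'\rangle=\det(\langle w_i,w_j'\rangle)_{1\le i,j\le p}$, and the Hodge star operator $\ast:\wedge^pW\to\wedge^{m-p}W$ is determined by $\langle\ast\alpha,\beta\rangle\,\Omega=\alpha\wedge\beta$ for all $\alpha\in\wedge^pW$, $\beta\in\wedge^{m-p}W$, where $\Omega\in\wedge^mW$ is the volume form associated with the inner product and orientation (the unit vector of $\wedge^m W$ that is positive for the orientation). Here $\wedge^1W=W$. *)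

theory Defs
  imports
    "HOL-Analysis.Inner_Product"
    "HOL-Library.Poly_Mapping"
    "Jordan_Normal_Form.Determinant"
begin

section \<open>Gram--Schmidt process and Gram determinants\<close>

fun gram_schmidt :: "(nat \<Rightarrow> 'a::real_inner) \<Rightarrow> nat \<Rightarrow> 'a" where
  "gram_schmidt v k =
     v k - (\<Sum>i<k. (inner (v k) (gram_schmidt v i) /
                     inner (gram_schmidt v i) (gram_schmidt v i)) *\<^sub>R gram_schmidt v i)"

declare gram_schmidt.simps [simp del]

definition gram_det :: "(nat \<Rightarrow> 'a::real_inner) \<Rightarrow> nat \<Rightarrow> real" where
  "gram_det v k = det (mat k k (\<lambda>(i, j). inner (v i) (v j)))"

section \<open>The exterior algebra of a real vector space\<close>

text \<open>
  The exterior algebra is the quotient of the tensor algebra by the squares of vectors.  The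
  tensor algebra is itself a quotient of the free associative algebra on the underlying set of
  the vector space (finitely supported functions on words, multiplied by convolution) by
  linearity of the letters; both quotients are taken in one step.
\<close>

datatype 'a word = Word (letters: "'a list")

instantiation word :: (type) monoid_add
begin
definition zero_word where "0 = Word []"
definition plus_word where "u + w = Word (letters u @ letters w)"
instance by standard (auto simp: zero_word_def plus_word_def)
end

type_synonym 'a free_alg = "'a word \<Rightarrow>\<^sub>0 real"

abbreviation fmono :: "'a list \<Rightarrow> 'a free_alg" where
  "fmono xs \<equiv> Poly_Mapping.single (Word xs) 1"

abbreviation scal :: "real \<Rightarrow> 'a free_alg" where
  "scal c \<equiv> Poly_Mapping.single 0 c"

inductive_set ext_relations :: "'a::real_vector free_alg set" where
  add: "fmono [x + y] - fmono [x] - fmono [y] \<in> ext_relations"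
| scale: "fmono [c *\<^sub>R x] - scal c * fmono [x] \<in> ext_relations"
| square: "fmono [x] * fmono [x] \<in> ext_relations"

text \<open>The two-sided ideal generated by these relations.\<close>

inductive_set ext_ideal :: "'a::real_vector free_alg set" where
  zero: "0 \<in> ext_ideal"
| step: "p \<in> ext_ideal \<Longrightarrow> r \<in> ext_relations \<Longrightarrow> p + a * r * b \<in> ext_ideal"

lemma ext_ideal_add: "q \<in> ext_ideal \<Longrightarrow> p \<in> ext_ideal \<Longrightarrow> p + q \<in> ext_ideal"
  by (induction rule: ext_ideal.induct) (auto simp: add.assoc[symmetric] intro: ext_ideal.step)

lemma ext_ideal_mult: "p \<in> ext_ideal \<Longrightarrow> s * p * t \<in> ext_ideal"
proof (induction rule: ext_ideal.induct)
  case (step p r a b)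
  have "s * (p + a * r * b) * t = s * p * t + (s * a) * r * (b * t)"
    by (simp add: algebra_simps)
  then show ?case using ext_ideal.step[OF step.IH step.hyps(2), of "s * a" "b * t"] by simp
qed (simp add: ext_ideal.zero)

lemma ext_ideal_mult_left: "p \<in> ext_ideal \<Longrightarrow> s * p \<in> ext_ideal"
  using ext_ideal_mult[of p s 1] by simp

lemma ext_ideal_mult_right: "p \<in> ext_ideal \<Longrightarrow> p * t \<in> ext_ideal"
  using ext_ideal_mult[of p 1 t] by simp

lemma ext_ideal_minus: "p \<in> ext_ideal \<Longrightarrow> - p \<in> ext_ideal"
  using ext_ideal_mult_left[of p "- 1"] by simp

lemma ext_ideal_relation: "r \<in> ext_relations \<Longrightarrow> r \<in> ext_ideal"
  using ext_ideal.step[OF ext_ideal.zero, of r 1 1] by simp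

definition ext_rel :: "'a::real_vector free_alg \<Rightarrow> 'a free_alg \<Rightarrow> bool" where
  "ext_rel p q \<longleftrightarrow> p - q \<in> ext_ideal"

lemma equivp_ext_rel: "equivp (ext_rel :: 'a::real_vector free_alg \<Rightarrow> _)"
proof (rule equivpI)
  show "reflp (ext_rel :: 'a free_alg \<Rightarrow> _)"
    by (simp add: reflp_def ext_rel_def ext_ideal.zero)
  show "symp (ext_rel :: 'a free_alg \<Rightarrow> _)"
    unfolding symp_def ext_rel_def by (metis ext_ideal_minus minus_diff_eq)
  show "transp (ext_rel :: 'a free_alg \<Rightarrow> _)"
  proof (rule transpI)
    fix x y z :: "'a free_alg"
    assume "ext_rel x y" "ext_rel y z"
    then have "(x - y) + (y - z) \<in> ext_ideal"
      unfolding ext_rel_def by (intro ext_ideal_add)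
    then show "ext_rel x z" by (simp add: ext_rel_def)
  qed
qed

quotient_type (overloaded) 'a ext = "'a::real_vector word \<Rightarrow>\<^sub>0 real" / ext_rel
  by (rule equivp_ext_rel)

lemma free_alg_induct [case_names single add]:
  fixes p :: "'a free_alg"
  assumes single: "\<And>xs c. P (Poly_Mapping.single (Word xs) c)"
    and add: "\<And>p q. P p \<Longrightarrow> P q \<Longrightarrow> P (p + q)"
  shows "P p"
proof -
  have eq: "p = (\<Sum>w\<in>Poly_Mapping.keys p. Poly_Mapping.single w (Poly_Mapping.lookup p w))"
    by (rule poly_mapping_eqI)
       (simp add: lookup_sum lookup_single when_def in_keys_iff)
  have "P (\<Sum>w\<in>A. Poly_Mapping.single w (Poly_Mapping.lookup p w))" if "finite A" for A
    using that
  proof induction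
    case empty
    then show ?case using single[of "[]" 0] by simp
  next
    case (insert w A)
    then show ?case using add single[of "letters w"] by simp
  qed
  then show ?thesis using eq by (metis finite_keys)
qed

lemma scal_commute: "p * scal c = scal c * (p :: 'a free_alg)"
  by (induction p rule: free_alg_induct) (auto simp: mult_single algebra_simps)

lemma lookup_zero_mult:
  fixes p q :: "'a free_alg"
  shows "Poly_Mapping.lookup (p * q) 0 = Poly_Mapping.lookup p 0 * Poly_Mapping.lookup q 0"
proof (induction p rule: free_alg_induct)
  case (single xs c)
  show ?case
    by (induction q rule: free_alg_induct)
       (auto simp: mult_single lookup_single when_def zero_word_def plus_word_def lookup_add
         algebra_simps)
qed (simp add: lookup_add algebra_simps)

lemma lookup_zero_ext_ideal: "p \<in> ext_ideal \<Longrightarrow> Poly_Mapping.lookup p 0 = 0"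
proof (induction rule: ext_ideal.induct)
  case (step p r a b)
  from step.hyps(2) have "Poly_Mapping.lookup r 0 = 0"
  proof cases
    case add
    then show ?thesis by (simp add: lookup_minus lookup_single when_def zero_word_def)
  qed (simp_all add: lookup_minus lookup_zero_mult, simp_all add: lookup_single when_def zero_word_def)
  then show ?case using step.IH by (simp add: lookup_add lookup_zero_mult)
qed simp

text \<open>The product of this algebra is the wedge product.\<close>

instantiation ext :: (real_vector) real_algebra_1
begin

lift_definition zero_ext :: "'a ext" is 0 .
lift_definition one_ext :: "'a ext" is 1 .

lift_definition plus_ext :: "'a ext \<Rightarrow> 'a ext \<Rightarrow> 'a ext" is "(+)"
  unfolding ext_rel_def by (metis add_diff_add ext_ideal_add)

lift_definition uminus_ext :: "'a ext \<Rightarrow> 'a ext" is uminus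
  unfolding ext_rel_def by (metis ext_ideal_minus minus_diff_minus)

lift_definition minus_ext :: "'a ext \<Rightarrow> 'a ext \<Rightarrow> 'a ext" is "(-)"
proof -
  fix a b c d :: "'a free_alg"
  assume "ext_rel a b" "ext_rel c d"
  then have "(a - b) + - (c - d) \<in> ext_ideal"
    unfolding ext_rel_def by (intro ext_ideal_add ext_ideal_minus)
  then show "ext_rel (a - c) (b - d)" by (simp add: ext_rel_def algebra_simps)
qed

lift_definition times_ext :: "'a ext \<Rightarrow> 'a ext \<Rightarrow> 'a ext" is "(*)"
proof -
  fix a b c d :: "'a free_alg"
  assume "ext_rel a b" "ext_rel c d"
  then have "(a - b) * c + b * (c - d) \<in> ext_ideal"
    unfolding ext_rel_def by (intro ext_ideal_add ext_ideal_mult_left ext_ideal_mult_right)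
  then show "ext_rel (a * c) (b * d)" by (simp add: ext_rel_def algebra_simps)
qed

lift_definition scaleR_ext :: "real \<Rightarrow> 'a ext \<Rightarrow> 'a ext" is "\<lambda>c p. scal c * p"
  unfolding ext_rel_def by (metis ext_ideal_mult_left right_diff_distrib)

instance
proof
  have refl: "ext_rel p p" for p :: "'a free_alg"
    by (simp add: ext_rel_def ext_ideal.zero)
  fix a b c :: "'a ext" and s t :: real
  show "a + b + c = a + (b + c)" by transfer (simp add: refl add.assoc)
  show "a + b = b + a" by transfer (simp add: refl add.commute)
  show "0 + a = a" by transfer (simp add: refl)
  show "- a + a = 0" by transfer (simp add: refl)
  show "a - b = a + - b" by transfer (simp add: refl)
  show "a * b * c = a * (b * c)" by transfer (simp add: refl mult.assoc)
  show "1 * a = a" by transfer (simp add: refl)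
  show "a * 1 = a" by transfer (simp add: refl)
  show "(a + b) * c = a * c + b * c" by transfer (simp add: refl distrib_right)
  show "a * (b + c) = a * b + a * c" by transfer (simp add: refl distrib_left)
  show "(0 :: 'a ext) \<noteq> 1"
    by transfer (auto simp: ext_rel_def lookup_minus lookup_one dest: lookup_zero_ext_ideal)
  show "s *\<^sub>R (a + b) = s *\<^sub>R a + s *\<^sub>R b" by transfer (simp add: refl distrib_left)
  show "(s + t) *\<^sub>R a = s *\<^sub>R a + t *\<^sub>R a" by transfer (simp add: refl single_add distrib_right)
  show "s *\<^sub>R t *\<^sub>R a = (s * t) *\<^sub>R a"
    by transfer (simp add: refl mult.assoc[symmetric] mult_single)
  show "1 *\<^sub>R a = a" by transfer (simp add: refl)
  show "s *\<^sub>R a * b = s *\<^sub>R (a * b)" by transfer (simp add: refl mult.assoc)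
  show "a * s *\<^sub>R b = s *\<^sub>R (a * b)"
    by transfer (metis refl mult.assoc scal_commute)
qed

end

text \<open>
  The canonical embedding of the vector space as the degree-one part, through which a vector
  is regarded as an element of the first exterior power.
\<close>

lift_definition ext_of :: "'a::real_vector \<Rightarrow> 'a ext" is "\<lambda>x. fmono [x]" .

definition wedge :: "'a::real_vector list \<Rightarrow> 'a ext" where
  "wedge xs = prod_list (map ext_of xs)"

text \<open>
  The \<open>p\<close>-th exterior power of a subspace \<open>W\<close>, viewed inside the exterior algebra of the
  ambient space (the canonical map induced by the inclusion of \<open>W\<close> is injective).
\<close>

definition ext_power :: "nat \<Rightarrow> 'a::real_vector set \<Rightarrow> 'a ext set" where
  "ext_power p W = span {wedge ws | ws. length ws = p \<and> set ws \<subseteq> W}"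

lemma ext_of_add: "ext_of (x + y) = ext_of x + ext_of y"
proof transfer
  fix x y :: 'a
  show "ext_rel (fmono [x + y]) (fmono [x] + fmono [y])"
    using ext_ideal_relation[OF ext_relations.add[of x y]]
    by (simp add: ext_rel_def diff_diff_eq)
qed

lemma ext_of_scaleR: "ext_of (c *\<^sub>R x) = c *\<^sub>R ext_of x"
  by transfer (simp add: ext_rel_def ext_ideal_relation ext_relations.scale)

lemma ext_of_square: "ext_of x * ext_of x = 0"
  by transfer (simp add: ext_rel_def ext_ideal_relation ext_relations.square)

lemma wedge_eq_abs: "wedge xs = abs_ext (fmono xs)"
proof (induction xs)
  case Nil
  then show ?case by (simp add: wedge_def one_ext_def zero_word_def[symmetric])
next
  case (Cons x xs)
  have "wedge (x # xs) = ext_of x * wedge xs" by (simp add: wedge_def)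
  also have "\<dots> = abs_ext (fmono [x] * fmono xs)"
    by (simp add: Cons ext_of.abs_eq times_ext.abs_eq)
  finally show ?case by (simp add: mult_single plus_word_def)
qed

section \<open>The inner product on exterior powers\<close>

definition gram_pair :: "'a::real_inner list \<Rightarrow> 'a list \<Rightarrow> real" where
  "gram_pair xs ys =
     (if length xs = length ys
      then det (mat (length xs) (length xs) (\<lambda>(i, j). inner (xs ! i) (ys ! j)))
      else 0)"

lemma gram_pair_sym: "gram_pair xs ys = gram_pair ys xs"
proof (cases "length xs = length ys")
  case True
  let ?n = "length ys"
  have "mat ?n ?n (\<lambda>(i, j). inner (ys ! i) (xs ! j)) =
        transpose_mat (mat ?n ?n (\<lambda>(i, j). inner (xs ! i) (ys ! j)))"
    by (rule eq_matI) (auto simp: inner_commute)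
  then show ?thesis
    using True det_transpose[of "mat ?n ?n (\<lambda>(i, j). inner (xs ! i) (ys ! j))" ?n]
    by (simp add: gram_pair_def)
qed (simp add: gram_pair_def)

lemma gram_pair_expand:
  "gram_pair (us @ x # ws) ys =
     (if length us + Suc (length ws) = length ys
      then \<Sum>p | p permutes {0..<length ys}. signof p *
             (inner x (ys ! p (length us)) *
              (\<Prod>i\<in>{0..<length ys} - {length us}.
                 inner ((us @ undefined # ws) ! i) (ys ! p i)))
      else 0)"
proof (cases "length us + Suc (length ws) = length ys")
  case True
  let ?n = "length ys" and ?xs = "us @ x # ws"
  have "gram_pair ?xs ys =
      (\<Sum>p | p permutes {0..<?n}. signof p * (\<Prod>i=0..<?n. inner (?xs ! i) (ys ! p i)))"
    using True
    by (auto simp: gram_pair_def det_def intro!: sum.cong prod.cong)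
  also have "\<dots> = (\<Sum>p | p permutes {0..<?n}. signof p *
             (inner x (ys ! p (length us)) *
              (\<Prod>i\<in>{0..<?n} - {length us}.
                 inner ((us @ undefined # ws) ! i) (ys ! p i))))"
  proof (rule sum.cong)
    fix p
    have "(\<Prod>i=0..<?n. inner (?xs ! i) (ys ! p i)) =
        inner (?xs ! length us) (ys ! p (length us)) *
        (\<Prod>i\<in>{0..<?n} - {length us}. inner (?xs ! i) (ys ! p i))"
      using True by (intro prod.remove) auto
    also have "(\<Prod>i\<in>{0..<?n} - {length us}. inner (?xs ! i) (ys ! p i)) =
        (\<Prod>i\<in>{0..<?n} - {length us}. inner ((us @ undefined # ws) ! i) (ys ! p i))"
      by (rule prod.cong) (auto simp: nth_append nth_Cons')
    finally show "signof p * (\<Prod>i=0..<?n. inner (?xs ! i) (ys ! p i)) = signof p *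
             (inner x (ys ! p (length us)) *
              (\<Prod>i\<in>{0..<?n} - {length us}.
                 inner ((us @ undefined # ws) ! i) (ys ! p i)))" by simp
  qed simp
  finally show ?thesis using True by simp
qed (simp add: gram_pair_def)

lemma gram_pair_add:
  "gram_pair (us @ (x + y) # ws) ys = gram_pair (us @ x # ws) ys + gram_pair (us @ y # ws) ys"
  unfolding gram_pair_expand by (simp add: inner_add_left algebra_simps sum.distrib)

lemma gram_pair_scaleR:
  "gram_pair (us @ (c *\<^sub>R x) # ws) ys = c * gram_pair (us @ x # ws) ys"
  unfolding gram_pair_expand by (simp add: algebra_simps sum_distrib_left)

lemma gram_pair_square: "gram_pair (us @ x # x # ws) ys = 0"
proof (cases "length us + Suc (Suc (length ws)) = length ys")
  case True
  let ?n = "length ys"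
  let ?A = "mat ?n ?n (\<lambda>(i, j). inner ((us @ x # x # ws) ! i) (ys ! j))"
  have "row ?A (length us) = row ?A (Suc (length us))"
    using True by (intro eq_vecI) (auto simp: nth_append)
  then have "det ?A = 0"
    using True by (intro det_identical_rows[of ?A ?n "length us" "Suc (length us)"]) auto
  then show ?thesis using True by (simp add: gram_pair_def)
qed (simp add: gram_pair_def)

definition free_inner :: "'a::real_inner free_alg \<Rightarrow> 'a free_alg \<Rightarrow> real" where
  "free_inner p q =
     (\<Sum>u\<in>Poly_Mapping.keys p. \<Sum>w\<in>Poly_Mapping.keys q.
        Poly_Mapping.lookup p u * Poly_Mapping.lookup q w * gram_pair (letters u) (letters w))"

lemma free_inner_sym: "free_inner p q = free_inner q p"
  unfolding free_inner_def by (subst sum.swap) (simp add: gram_pair_sym mult_ac)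

lemma free_inner_superset:
  assumes "finite A" "Poly_Mapping.keys p \<subseteq> A"
  shows "free_inner p q =
     (\<Sum>u\<in>A. \<Sum>w\<in>Poly_Mapping.keys q.
        Poly_Mapping.lookup p u * Poly_Mapping.lookup q w * gram_pair (letters u) (letters w))"
  unfolding free_inner_def
  using assms by (intro sum.mono_neutral_left) (auto simp: in_keys_iff)

lemma free_inner_add_left: "free_inner (p + q) r = free_inner p r + free_inner q r"
proof -
  let ?A = "Poly_Mapping.keys p \<union> Poly_Mapping.keys q"
  have "Poly_Mapping.keys (p + q) \<subseteq> ?A" by (rule Poly_Mapping.keys_add)
  then show ?thesis
    by (simp add: free_inner_superset[of ?A] lookup_add algebra_simps sum.distrib)
qed

lemma free_inner_uminus_left: "free_inner (- p) r = - free_inner p r"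
  by (simp add: free_inner_def sum_negf)

lemma free_inner_diff_left: "free_inner (p - q) r = free_inner p r - free_inner q r"
  using free_inner_add_left[of p "- q" r] by (simp add: free_inner_uminus_left)

lemma free_inner_single_left:
  "free_inner (Poly_Mapping.single u c) r =
     c * (\<Sum>w\<in>Poly_Mapping.keys r. Poly_Mapping.lookup r w * gram_pair (letters u) (letters w))"
  by (subst free_inner_superset[of "{u}"]) (auto simp: sum_distrib_left mult_ac)

lemma free_inner_ext_relation:
  fixes r :: "'a::real_inner free_alg"
  assumes "r \<in> ext_relations"
  shows "free_inner (a * r * b) q = 0"
proof (induction a rule: free_alg_induct)
  case a: (single us c)
  show ?case
  proof (induction b rule: free_alg_induct)
    case (single ws d)
    from assms show ?case
      by cases
        (simp_all only: left_diff_distrib right_diff_distrib,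
         simp_all add: mult_single free_inner_diff_left free_inner_add_left
          free_inner_single_left plus_word_def zero_word_def gram_pair_add gram_pair_scaleR
          gram_pair_square sum.distrib sum_distrib_left,
         simp_all add: algebra_simps sum.distrib)
  qed (simp add: distrib_left free_inner_add_left)
qed (simp add: distrib_right free_inner_add_left)

lemma free_inner_ext_ideal: "p \<in> ext_ideal \<Longrightarrow> free_inner p q = 0"
  by (induction rule: ext_ideal.induct)
     (simp_all add: free_inner_add_left free_inner_ext_relation, simp add: free_inner_def)

text \<open>
  The bilinear form on the exterior algebra with the determinant formula on decomposable
  elements of equal degree; different degrees are orthogonal.
\<close>

lift_definition ext_inner :: "'a::real_inner ext \<Rightarrow> 'a ext \<Rightarrow> real" is free_inner
proof -
  fix a b c d :: "'a free_alg"
  assume "ext_rel a b" "ext_rel c d"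
  then have "free_inner (a - b) c = 0" "free_inner (c - d) b = 0"
    by (simp_all add: ext_rel_def free_inner_ext_ideal)
  then have "free_inner a c = free_inner b c" "free_inner c b = free_inner d b"
    by (simp_all add: free_inner_diff_left)
  then show "free_inner a c = free_inner b d"
    by (simp add: free_inner_sym[of b])
qed

lemma ext_inner_sym: "ext_inner a b = ext_inner b a"
  by transfer (rule free_inner_sym)

lemma ext_inner_add_left: "ext_inner (a + b) c = ext_inner a c + ext_inner b c"
  by transfer (rule free_inner_add_left)

lemma ext_inner_scaleR_left: "ext_inner (s *\<^sub>R a) b = s * ext_inner a b"
proof transfer
  fix s :: real and a b :: "'a free_alg"
  show "free_inner (scal s * a) b = s * free_inner a b"
    by (induction a rule: free_alg_induct)
       (simp_all add: mult_single free_inner_single_left distrib_left free_inner_add_left)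
qed

lemma ext_inner_wedge:
  assumes "length xs = length ys"
  shows "ext_inner (wedge xs) (wedge ys) =
    det (mat (length xs) (length xs) (\<lambda>(i, j). inner (xs ! i) (ys ! j)))"
proof -
  have "ext_inner (wedge xs) (wedge ys) = free_inner (fmono xs) (fmono ys)"
    by (simp add: wedge_eq_abs ext_inner.abs_eq)
  also have "\<dots> = gram_pair xs ys"
    by (simp add: free_inner_single_left)
  finally show ?thesis using assms by (simp add: gram_pair_def)
qed

section \<open>Orientation, volume form and Hodge star\<close>

text \<open>
  An orientation of an \<open>m\<close>-dimensional space is represented by the ray of its positive
  elements in the one-dimensional top exterior power; an ordered basis determines the
  orientation for which it is positive.  The degree \<open>p\<close> of the argument of the Hodge star
  is an explicit parameter.
\<close>

definition orientation_of :: "'a::real_vector list \<Rightarrow> 'a ext set" where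
  "orientation_of bs = {c *\<^sub>R wedge bs | c. 0 < c}"

definition volume_form :: "'a::real_inner set \<Rightarrow> 'a ext set \<Rightarrow> 'a ext" where
  "volume_form W ori =
     (THE \<omega>. \<omega> \<in> ext_power (dim W) W \<and> \<omega> \<in> ori \<and> ext_inner \<omega> \<omega> = 1)"

definition hodge_star ::
    "'a::real_inner set \<Rightarrow> 'a ext set \<Rightarrow> nat \<Rightarrow> 'a ext \<Rightarrow> 'a ext" where
  "hodge_star W ori p \<alpha> =
     (THE \<eta>. \<eta> \<in> ext_power (dim W - p) W \<and>
        (\<forall>\<beta>\<in>ext_power (dim W - p) W.
            ext_inner \<eta> \<beta> *\<^sub>R volume_form W ori = \<alpha> * \<beta>))"

end

theory Submission
  imports Defs
begin

text \<open>
  Write \<open>u\<close> for the \<open>k\<close>-th Gram--Schmidt vector, \<open>\<alpha>\<close> for the wedge of \<open>v 0, \<dots>, v (k - 1)\<close>,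
  \<open>d\<close> and \<open>d'\<close> for the Gram determinants of the first \<open>k\<close> and the first \<open>k + 1\<close> vectors, and
  \<open>W\<close> for the span of \<open>v 0, \<dots>, v k\<close>.  The Hodge star of \<open>\<alpha>\<close> is a vector orthogonal to
  \<open>v 0, \<dots>, v (k - 1)\<close>, because wedging \<open>\<alpha>\<close> with any of these gives zero; within \<open>W\<close> this
  leaves only the multiples of \<open>u\<close>, and the whole content is the scalar.

  Replacing the last factor \<open>v k\<close> of a wedge product by \<open>u\<close> changes it by the wedge of \<open>\<alpha>\<close>
  with an element of the span of its own factors, that is, not at all
  (\<open>wedge_gram_schmidt\<close>).  As \<open>u\<close> is orthogonal to the factors of \<open>\<alpha>\<close>, the squared norm of
  \<open>\<alpha> * u\<close> is the product of the squared norms (\<open>ext_inner_wedge_snoc_orthogonal\<close>), which gives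
  \<open>d' = d * inner u u\<close> (\<open>gram_det_Suc\<close>).  The volume form is \<open>\<alpha> * u\<close> divided by its norm
  \<open>sqrt d'\<close> (\<open>volume_form_orientation_of\<close>).  Testing the equation of the Hodge star at
  \<open>v k\<close>, where \<open>inner u (v k) = inner u u = d' / d\<close>, shows that \<open>(d / sqrt d') u\<close> solves it,
  and its solution is unique (\<open>hodge_star_codim_1_eqI\<close>).
\<close>

section \<open>Gram--Schmidt vectors\<close>

text \<open>
  This holds for every family: an earlier vector that vanishes is orthogonal to everything, and
  its coefficient in the sum is a division by zero, that is, \<open>0\<close>.
\<close>

lemma gram_schmidt_orthogonal_less:
  assumes "j < k"
  shows "inner (gram_schmidt v k) (gram_schmidt v j) = 0"
  using assms
proof (induction k arbitrary: j rule: less_induct)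
  case (less k)
  let ?u = "gram_schmidt v"
  have ortho: "inner (?u i) (?u j) = 0" if "i < k" "i \<noteq> j" for i
    using that less.IH[of i j] less.IH[of j i] less.prems
    by (cases "i < j") (auto simp: inner_commute)
  have "(\<Sum>i<k. inner (v k) (?u i) / inner (?u i) (?u i) * inner (?u i) (?u j)) =
      (\<Sum>i<k. if i = j then inner (v k) (?u j) else 0)"
    by (rule sum.cong) (auto simp: ortho)
  also have "\<dots> = inner (v k) (?u j)"
    using less.prems by simp
  finally show ?case
    by (subst gram_schmidt.simps) (simp add: inner_diff_left inner_sum_left)
qed

lemma inner_gram_schmidt:
  assumes "i \<le> k"
  shows "inner (v i) (gram_schmidt v k) = inner (gram_schmidt v i) (gram_schmidt v k)"
proof -
  let ?u = "gram_schmidt v"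
  have "v i = ?u i + (\<Sum>j<i. (inner (v i) (?u j) / inner (?u j) (?u j)) *\<^sub>R ?u j)"
    by (subst gram_schmidt.simps) simp
  also have "inner \<dots> (?u k) = inner (?u i) (?u k)"
    using assms gram_schmidt_orthogonal_less[of _ k v]
    by (simp add: inner_commute[of _ "?u k"] inner_add_right inner_sum_right)
  finally show ?thesis .
qed

lemma inner_gram_schmidt_less:
  "i < k \<Longrightarrow> inner (v i) (gram_schmidt v k) = 0"
  using inner_gram_schmidt[of i k v] gram_schmidt_orthogonal_less[of i k v]
  by (simp add: inner_commute)

lemma diff_gram_schmidt_in_span: "v k - gram_schmidt v k \<in> span (v ` {..<k})"
proof (induction k rule: less_induct)
  case (less k)
  let ?u = "gram_schmidt v"
  have "?u i \<in> span (v ` {..<k})" if "i < k" for i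
  proof -
    have "v i - ?u i \<in> span (v ` {..<k})"
      by (rule subsetD[OF span_mono less[OF that]]) (use that in auto)
    moreover have "v i \<in> span (v ` {..<k})"
      using that by (intro span_base) auto
    ultimately show ?thesis
      using span_diff by fastforce
  qed
  then show ?case
    by (subst gram_schmidt.simps) (auto intro!: span_sum span_scale)
qed

lemma gram_schmidt_in_span: "gram_schmidt v k \<in> span (v ` {..k})"
proof -
  have "v k - gram_schmidt v k \<in> span (v ` {..k})"
    by (rule subsetD[OF span_mono diff_gram_schmidt_in_span]) auto
  moreover have "v k \<in> span (v ` {..k})"
    by (intro span_base) auto
  ultimately show ?thesis
    using span_diff by fastforce
qed

text \<open>
  Otherwise \<open>v k\<close> would lie in the span of its predecessors; injectivity ensures that the
  predecessors are the elements of the family other than \<open>v k\<close>.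
\<close>

lemma gram_schmidt_nonzero:
  assumes "inj_on v {..k}" and "independent (v ` {..k})"
  shows "gram_schmidt v k \<noteq> 0"
proof
  assume "gram_schmidt v k = 0"
  then have "v k \<in> span (v ` {..<k})"
    using diff_gram_schmidt_in_span[of v k] by simp
  moreover have "v ` {..<k} = v ` {..k} - {v k}"
    using assms(1) by (auto simp: inj_on_def less_le)
  ultimately show False
    using assms(2) by (auto simp: dependent_def)
qed

section \<open>Wedge products\<close>

lemma wedge_snoc: "wedge (xs @ [x]) = wedge xs * ext_of x"
  by (simp add: wedge_def)

text \<open>Polarization of \<open>x * x = 0\<close>.\<close>

lemma ext_of_anticommute: "ext_of x * ext_of y = - (ext_of y * ext_of x)"
proof -
  have "0 = ext_of (x + y) * ext_of (x + y)"
    by (simp add: ext_of_square)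
  also have "\<dots> = ext_of x * ext_of y + ext_of y * ext_of x"
    unfolding ext_of_add by (simp add: distrib_left distrib_right ext_of_square)
  finally show ?thesis
    by (simp add: eq_neg_iff_add_eq_0)
qed

text \<open>Anticommutation moves the left copy of \<open>x\<close> through the product until it meets the right one.\<close>

lemma ext_of_wedge_ext_of: "ext_of x * wedge ys * ext_of x = 0"
proof (induction ys)
  case Nil
  show ?case by (simp add: wedge_def ext_of_square)
next
  case (Cons y ys)
  have "ext_of x * wedge (y # ys) * ext_of x = ext_of x * ext_of y * (wedge ys * ext_of x)"
    by (simp add: wedge_def mult.assoc)
  also have "\<dots> = - (ext_of y * (ext_of x * wedge ys * ext_of x))"
    by (subst ext_of_anticommute) (simp add: mult.assoc)
  finally show ?case using Cons by simp
qed

lemma wedge_mult_member: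
  assumes "x \<in> set xs"
  shows "wedge xs * ext_of x = 0"
  using assms
proof (induction xs)
  case (Cons y ys)
  show ?case
  proof (cases "x = y")
    case True
    then show ?thesis
      using ext_of_wedge_ext_of[of x ys] by (simp add: wedge_def)
  next
    case False
    then show ?thesis
      using Cons by (simp add: wedge_def mult.assoc)
  qed
qed simp

lemma linear_ext_of: "linear ext_of"
  by (rule linearI) (simp_all add: ext_of_add ext_of_scaleR)

lemma ext_of_0: "ext_of 0 = 0"
  by (rule linear_0[OF linear_ext_of])

lemma ext_of_diff: "ext_of (x - y) = ext_of x - ext_of y"
  by (rule linear_diff[OF linear_ext_of])

lemma wedge_mult_span:
  assumes "x \<in> span (set xs)"
  shows "wedge xs * ext_of x = 0"
  using assms
  by (induction rule: span_induct_alt)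
    (simp_all add: ext_of_0 ext_of_add ext_of_scaleR distrib_left wedge_mult_member)

lemma wedge_snoc_cong:
  assumes "x - y \<in> span (set xs)"
  shows "wedge (xs @ [x]) = wedge (xs @ [y])"
  using wedge_mult_span[OF assms] by (simp add: wedge_snoc ext_of_diff right_diff_distrib)

text \<open>
  The embedding is linear, so its image is already a subspace.  This is what reduces the Hodge
  star in codimension one to a statement about vectors.
\<close>

lemma ext_power_1:
  assumes "subspace W"
  shows "ext_power 1 W = ext_of ` W"
proof -
  have "{wedge ws | ws. length ws = 1 \<and> set ws \<subseteq> W} = ext_of ` W"
    by (force simp: length_Suc_conv wedge_def)
  moreover have "span (ext_of ` W) = ext_of ` span W"
    by (rule linear_span_image[OF linear_ext_of])
  moreover have "span W = W"
    using assms by (simp add: span_eq_iff)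
  ultimately show ?thesis
    by (simp only: ext_power_def)
qed

section \<open>Gram determinants as squared norms\<close>

lemma ext_inner_ext_of: "ext_inner (ext_of x) (ext_of y) = inner x y"
proof -
  have "ext_inner (wedge [x]) (wedge [y]) = inner x y"
    by (subst ext_inner_wedge) (simp_all add: det_single)
  then show ?thesis
    by (simp add: wedge_def)
qed

lemma ext_inner_scaleR_both: "ext_inner (s *\<^sub>R a) (t *\<^sub>R b) = s * t * ext_inner a b"
  by (simp add: ext_inner_scaleR_left ext_inner_sym[of a "t *\<^sub>R b"] ext_inner_sym[of b a])

text \<open>
  Volume is base times height: the Gram matrix is block diagonal, and expanding its determinant
  along the last row leaves one term.
\<close>

lemma ext_inner_wedge_snoc_orthogonal:
  assumes "\<And>x. x \<in> set xs \<Longrightarrow> inner x w = 0"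
  shows "ext_inner (wedge (xs @ [w])) (wedge (xs @ [w])) =
    ext_inner (wedge xs) (wedge xs) * inner w w"
proof -
  let ?n = "length xs" and ?ys = "xs @ [w]"
  define A where "A = mat (Suc ?n) (Suc ?n) (\<lambda>(i, j). inner (?ys ! i) (?ys ! j))"
  have A: "A \<in> carrier_mat (Suc ?n) (Suc ?n)"
    by (simp add: A_def)
  have row: "A $$ (?n, j) = 0" if "j < ?n" for j
    using that assms[of "xs ! j"] by (simp add: A_def nth_append inner_commute)
  have minor: "mat_delete A ?n ?n = mat ?n ?n (\<lambda>(i, j). inner (xs ! i) (xs ! j))"
    by (rule eq_matI) (auto simp: mat_delete_def A_def nth_append)
  have "det A = (\<Sum>j<Suc ?n. A $$ (?n, j) * cofactor A ?n j)"
    by (rule laplace_expansion_row[OF A]) simp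
  also have "\<dots> = A $$ (?n, ?n) * cofactor A ?n ?n"
    by (simp add: row)
  also have "\<dots> = inner w w * ext_inner (wedge xs) (wedge xs)"
    by (simp add: cofactor_def minor ext_inner_wedge) (simp add: A_def)
  finally show ?thesis
    by (simp add: ext_inner_wedge A_def mult.commute)
qed

lemma gram_det_eq_ext_inner:
  "gram_det v k = ext_inner (wedge (map v [0..<k])) (wedge (map v [0..<k]))"
  unfolding gram_det_def
  by (subst ext_inner_wedge) (auto intro!: arg_cong[of _ _ det] eq_matI)

text \<open>
  The correction made by the Gram--Schmidt step is a combination of the other factors, so the
  wedge product does not see it.
\<close>

lemma wedge_gram_schmidt:
  "wedge (map v [0..<Suc k]) = wedge (map v [0..<k]) * ext_of (gram_schmidt v k)"
proof -
  have "wedge (map v [0..<k] @ [v k]) = wedge (map v [0..<k] @ [gram_schmidt v k])"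
    using diff_gram_schmidt_in_span[of v k]
    by (intro wedge_snoc_cong) (simp add: atLeast0LessThan)
  then show ?thesis
    by (simp add: wedge_snoc)
qed

lemma gram_det_Suc:
  "gram_det v (Suc k) = gram_det v k * inner (gram_schmidt v k) (gram_schmidt v k)"
  unfolding gram_det_eq_ext_inner wedge_gram_schmidt wedge_snoc[symmetric]
  by (rule ext_inner_wedge_snoc_orthogonal) (auto simp: inner_gram_schmidt_less)

lemma gram_det_pos:
  assumes "inj_on v {..<k}" and "independent (v ` {..<k})"
  shows "gram_det v k > 0"
  using assms
proof (induction k)
  case 0
  show ?case by (simp add: gram_det_def)
next
  case (Suc k)
  have "inj_on v {..<k}" "independent (v ` {..<k})"
    by (rule inj_on_subset[OF Suc.prems(1)], simp)
      (rule independent_mono[OF Suc.prems(2)], intro image_mono, simp)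
  moreover have "gram_schmidt v k \<noteq> 0"
    using Suc.prems by (intro gram_schmidt_nonzero) (simp_all add: lessThan_Suc_atMost)
  ultimately show ?case
    using Suc.IH by (simp add: gram_det_Suc)
qed

section \<open>Volume form and Hodge star\<close>

text \<open>
  The orientation is a ray in a line on which the inner product is positive definite, so it
  meets the unit sphere once.
\<close>

lemma volume_form_orientation_of:
  assumes dim: "dim W = length bs" and "set bs \<subseteq> W"
    and pos: "ext_inner (wedge bs) (wedge bs) > 0"
  shows "volume_form W (orientation_of bs) =
    (1 / sqrt (ext_inner (wedge bs) (wedge bs))) *\<^sub>R wedge bs"
  unfolding volume_form_def
proof (rule the_equality, intro conjI)
  let ?d = "ext_inner (wedge bs) (wedge bs)"
  have "wedge bs \<in> ext_power (dim W) W"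
    unfolding ext_power_def using assms by (intro span_base) auto
  then show "(1 / sqrt ?d) *\<^sub>R wedge bs \<in> ext_power (dim W) W"
    unfolding ext_power_def by (rule span_scale)
  show "(1 / sqrt ?d) *\<^sub>R wedge bs \<in> orientation_of bs"
    unfolding orientation_of_def using pos by auto
  show "ext_inner ((1 / sqrt ?d) *\<^sub>R wedge bs) ((1 / sqrt ?d) *\<^sub>R wedge bs) = 1"
    using pos by (simp add: ext_inner_scaleR_both)
  fix \<omega>
  assume "\<omega> \<in> ext_power (dim W) W \<and> \<omega> \<in> orientation_of bs \<and> ext_inner \<omega> \<omega> = 1"
  then obtain c where c: "\<omega> = c *\<^sub>R wedge bs" "c > 0" and "ext_inner \<omega> \<omega> = 1"
    unfolding orientation_of_def by blast
  then have "c * c * ?d = 1"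
    by (simp add: ext_inner_scaleR_both)
  then have "sqrt (c * c * ?d) = 1"
    by simp
  then have "c * sqrt ?d = 1"
    using c(2) by (simp add: real_sqrt_mult)
  then have "c = 1 / sqrt ?d"
    using pos by (simp add: field_simps)
  with c(1) show "\<omega> = (1 / sqrt ?d) *\<^sub>R wedge bs"
    by simp
qed

text \<open>
  Since the volume form is nonzero, the equation of the Hodge star prescribes \<open>inner x y\<close> for all \<open>y\<close> in \<open>W\<close>, hence determines
  \<open>x\<close>: two solutions differ by a vector of \<open>W\<close> that is orthogonal to \<open>W\<close>.
\<close>

lemma hodge_star_codim_1_eqI:
  assumes "subspace W" and "dim W - p = 1" and "volume_form W ori \<noteq> 0" and "x \<in> W"
    and hodge: "\<And>y. y \<in> W \<Longrightarrow> inner x y *\<^sub>R volume_form W ori = \<alpha> * ext_of y"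
  shows "hodge_star W ori p \<alpha> = ext_of x"
  unfolding hodge_star_def \<open>dim W - p = 1\<close> ext_power_1[OF assms(1)]
proof (rule the_equality)
  show "ext_of x \<in> ext_of ` W \<and>
      (\<forall>\<beta>\<in>ext_of ` W. ext_inner (ext_of x) \<beta> *\<^sub>R volume_form W ori = \<alpha> * \<beta>)"
    using assms by (auto simp: ext_inner_ext_of)
next
  fix \<eta>
  assume "\<eta> \<in> ext_of ` W \<and>
      (\<forall>\<beta>\<in>ext_of ` W. ext_inner \<eta> \<beta> *\<^sub>R volume_form W ori = \<alpha> * \<beta>)"
  then obtain z where z: "z \<in> W" "\<eta> = ext_of z"
    and star: "\<And>y. y \<in> W \<Longrightarrow> inner z y *\<^sub>R volume_form W ori = \<alpha> * ext_of y"
    by (auto simp: ext_inner_ext_of)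
  have "z - x \<in> W"
    using assms z by (intro subspace_diff)
  then have "inner z (z - x) *\<^sub>R volume_form W ori = inner x (z - x) *\<^sub>R volume_form W ori"
    by (simp add: star hodge)
  then have "inner (z - x) (z - x) = 0"
    using assms(3) by (simp add: inner_diff_left)
  then show "\<eta> = ext_of x"
    using z by simp
qed

theorem mainTheorem4:
  fixes v :: "nat \<Rightarrow> 'a::real_inner" and n k :: nat
  assumes "inj_on v {..n}" and "independent (v ` {..n})"
    and "1 \<le> k" and "k \<le> n"
  shows "ext_of (gram_schmidt v k) =
    (sqrt (gram_det v (k + 1)) / gram_det v k) *\<^sub>R
      hodge_star (span (v ` {..k})) (orientation_of (map v [0..<k + 1])) k
        (wedge (map v [0..<k]))"
proof -
  define u where "u = gram_schmidt v k"
  define d where "d = gram_det v k"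
  define d' where "d' = gram_det v (Suc k)"
  define W where "W = span (v ` {..k})"
  define bs where "bs = map v [0..<Suc k]"
  have inj: "inj_on v {..k}" and ind: "independent (v ` {..k})"
    using \<open>k \<le> n\<close>
    by (intro inj_on_subset[OF assms(1)] independent_mono[OF assms(2) image_mono]; simp)+
  then have d': "d' > 0"
    unfolding d'_def by (intro gram_det_pos) (simp_all add: lessThan_Suc_atMost)
  have d: "d > 0"
    unfolding d_def
    by (intro gram_det_pos inj_on_subset[OF inj] independent_mono[OF ind image_mono]) auto
  have d'_eq: "d' = d * inner u u"
    by (simp add: d'_def d_def u_def gram_det_Suc)
  have bs_inner: "ext_inner (wedge bs) (wedge bs) = d'"
    by (simp add: bs_def d'_def gram_det_eq_ext_inner)
  have dim: "dim W = Suc k"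
    unfolding W_def using inj ind by (subst dim_span_eq_card_independent) (simp_all add: card_image)
  have "set bs \<subseteq> W"
    unfolding bs_def W_def by (auto intro: span_base)
  then have vol: "volume_form W (orientation_of bs) = (1 / sqrt d') *\<^sub>R wedge bs"
    using volume_form_orientation_of[of W bs] dim bs_inner d' by (simp add: bs_def)
  have "wedge bs \<noteq> 0"
    using bs_inner d' ext_inner_scaleR_left[of 0 "wedge bs" "wedge bs"] by auto
  have "hodge_star W (orientation_of bs) k (wedge (map v [0..<k])) = ext_of ((d / sqrt d') *\<^sub>R u)"
  proof (rule hodge_star_codim_1_eqI)
    show "subspace W"
      by (simp add: W_def)
    show "dim W - k = 1"
      by (simp add: dim)
    show "volume_form W (orientation_of bs) \<noteq> 0"
      using vol d' \<open>wedge bs \<noteq> 0\<close> by simp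
    show "(d / sqrt d') *\<^sub>R u \<in> W"
      unfolding W_def u_def by (intro span_scale gram_schmidt_in_span)
    fix y
    assume "y \<in> W"
    \<comment> \<open>Both sides are linear in \<open>y\<close>, so only the generators \<open>v i\<close> of \<open>W\<close> matter:
      both sides vanish for \<open>i < k\<close>, and \<open>i = k\<close> fixes the scalar.\<close>
    then show "inner ((d / sqrt d') *\<^sub>R u) y *\<^sub>R volume_form W (orientation_of bs) =
        wedge (map v [0..<k]) * ext_of y"
      unfolding W_def
    proof (induction rule: span_induct_alt)
      case base
      show ?case by (simp add: ext_of_0)
    next
      case (step c x y)
      then obtain i where i: "x = v i" "i \<le> k" by auto
      let ?x = "(d / sqrt d') *\<^sub>R u"
      let ?\<Omega> = "volume_form (span (v ` {..k})) (orientation_of bs)"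
      have generator: "inner ?x x *\<^sub>R ?\<Omega> = wedge (map v [0..<k]) * ext_of x"
      proof (cases "i = k")
        case True
        have "inner u x = inner u u"
          using inner_gram_schmidt[of k k v] by (simp add: i True u_def inner_commute)
        then have "inner ((d / sqrt d') *\<^sub>R u) x * (1 / sqrt d') = 1"
          using d' d'_eq by (auto simp: field_simps)
        moreover have "wedge (map v [0..<k]) * ext_of x = wedge bs"
          by (simp add: bs_def i True flip: wedge_snoc)
        ultimately show ?thesis
          by (simp only: vol[unfolded W_def] scaleR_scaleR scaleR_one)
      next
        case False
        then have "inner u x = 0" and "wedge (map v [0..<k]) * ext_of x = 0"
          using i inner_gram_schmidt_less[of i k v]
          by (auto simp: u_def inner_commute intro!: wedge_mult_member)
        then show ?thesis
          by simp
      qed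
      have "inner ?x (c *\<^sub>R x + y) *\<^sub>R ?\<Omega> = c *\<^sub>R (inner ?x x *\<^sub>R ?\<Omega>) + inner ?x y *\<^sub>R ?\<Omega>"
        by (simp only: inner_add_right inner_scaleR_right scaleR_add_left scaleR_scaleR)
      also have "\<dots> = wedge (map v [0..<k]) * ext_of (c *\<^sub>R x + y)"
        by (simp only: generator step.IH ext_of_add ext_of_scaleR distrib_left mult_scaleR_right)
      finally show ?case .
    qed
  qed
  moreover have "(sqrt d' / d) * (d / sqrt d') = 1"
    using d d' by simp
  ultimately show ?thesis
    by (simp add: W_def bs_def d_def d'_def u_def ext_of_scaleR)
qed

end
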